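(* Consider the $[pqrs]$ random walk on $\{0,1,2,\dots\}$ described in the context, started in $i_0\ge0$, and let $x_n=\sum_{k=0}^\infty p_{i_0,n}^{(k)}$ be the expected number of arrivals (visits) in state $n$. Then $$x_0=-v_1^{-1}\xi_1^{1-i_0},$$ $$x_n=\begin{cases}\zeta_1\xi_1^{1-i_0}\left(\xi_1^{n-1}-\xi_2^{n-1}v_2v_1^{-1}\right)&(0<n\le i_0)\\ \zeta_1\xi_2^{n-1}\left(\xi_2^{1-i_0}-\xi_1^{1-i_0}v_2v_1^{-1}\right)&(n\ge i_0,\ n\ge1).\end{cases}$$
   Context: The walk: let $p,q,s>0$, $r\ge0$, $p+q+r+s=1$. In each state $n\ge1$, at each time step the particle moves to $n+1$ with probability $p$, moves to $n-1$ with probability $q$, stays in $n$ with probability $r$, or is absorbed in $n$ (removed) with probability $s$. In state $0$ it moves to $1$ with probability $p_0$, stays with probability $r_0$, is absorbed with probability $s_0$, where $p_0,s_0>0$, $r_0\ge0$, $p_0+r_0+s_0=1$. Here $p_{i,j}^{(k)}$ is the probability that the particle, starting in $i$ at time $0$, has not been absorbed and is in state $j$ after $k$ steps (so $p_{i,j}^{(0)}=\delta(i,j)$). Notation: $$\xi_1=\frac{(1-r)+\sqrt{(1-r)^2-4pq}}{2q},\quad \xi_2=\frac{(1-r)-\sqrt{(1-r)^2-4pq}}{2q},\quad \zeta_1=\left[(1-r)^2-4pq\right]^{-1/2},$$ $$v_i=p_0-(1-r_0)\xi_i\qquad(i=1,2).$$ *)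

theory Defs
  imports "HOL-Probability.Probability"
begin

(* One time step of the [pqrs] walk. A state is Some n while the particle is alive in n;
   None means that it has been absorbed. pmf_of_list is meaningful only for nonnegative
   weights of total 1 (otherwise it is unspecified), see the lemmas pmf_pqrs_step_* below. *)
fun pqrs_step ::
  "real \<Rightarrow> real \<Rightarrow> real \<Rightarrow> real \<Rightarrow> real \<Rightarrow> real \<Rightarrow> real \<Rightarrow> nat option \<Rightarrow> nat option pmf"
where
  "pqrs_step p q r s p0 r0 s0 None = return_pmf None"
| "pqrs_step p q r s p0 r0 s0 (Some 0) =
     pmf_of_list [(Some 1, p0), (Some 0, r0), (None, s0)]"
| "pqrs_step p q r s p0 r0 s0 (Some (Suc m)) =
     pmf_of_list [(Some (m + 2), p), (Some m, q), (Some (m + 1), r), (None, s)]"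

primrec pqrs_walk ::
  "real \<Rightarrow> real \<Rightarrow> real \<Rightarrow> real \<Rightarrow> real \<Rightarrow> real \<Rightarrow> real \<Rightarrow> nat \<Rightarrow> nat \<Rightarrow> nat option pmf"
where
  "pqrs_walk p q r s p0 r0 s0 i 0 = return_pmf (Some i)"
| "pqrs_walk p q r s p0 r0 s0 i (Suc k) =
     bind_pmf (pqrs_walk p q r s p0 r0 s0 i k) (pqrs_step p q r s p0 r0 s0)"

(* The k-step transition probability from i to j, usually written p_{i,j}^{(k)}. *)
definition pqrs_prob ::
  "real \<Rightarrow> real \<Rightarrow> real \<Rightarrow> real \<Rightarrow> real \<Rightarrow> real \<Rightarrow> real \<Rightarrow> nat \<Rightarrow> nat \<Rightarrow> nat \<Rightarrow> real"
where
  "pqrs_prob p q r s p0 r0 s0 i j k = pmf (pqrs_walk p q r s p0 r0 s0 i k) (Some j)"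

definition xi1 :: "real \<Rightarrow> real \<Rightarrow> real \<Rightarrow> real" where
  "xi1 p q r = ((1 - r) + sqrt ((1 - r)^2 - 4 * p * q)) / (2 * q)"

definition xi2 :: "real \<Rightarrow> real \<Rightarrow> real \<Rightarrow> real" where
  "xi2 p q r = ((1 - r) - sqrt ((1 - r)^2 - 4 * p * q)) / (2 * q)"

definition zeta1 :: "real \<Rightarrow> real \<Rightarrow> real \<Rightarrow> real" where
  "zeta1 p q r = ((1 - r)^2 - 4 * p * q) powr (-1/2)"

definition v1 :: "real \<Rightarrow> real \<Rightarrow> real \<Rightarrow> real \<Rightarrow> real \<Rightarrow> real" where
  "v1 p q r p0 r0 = p0 - (1 - r0) * xi1 p q r"

definition v2 :: "real \<Rightarrow> real \<Rightarrow> real \<Rightarrow> real \<Rightarrow> real \<Rightarrow> real" where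
  "v2 p q r p0 r0 = p0 - (1 - r0) * xi2 p q r"

lemma pmf_pqrs_step_Suc:
  assumes "0 \<le> p" "0 \<le> q" "0 \<le> r" "0 \<le> s" "p + q + r + s = 1"
  shows "pmf (pqrs_step p q r s p0 r0 s0 (Some (Suc m))) y =
    (if y = Some (m + 2) then p else if y = Some m then q
     else if y = Some (m + 1) then r else if y = None then s else 0)"
proof -
  have "pmf_of_list_wf [(Some (m + 2), p), (Some m, q), (Some (m + 1), r), (None, s)]"
    using assms by (auto simp: pmf_of_list_wf_def)
  then show ?thesis by (auto simp: pmf_pmf_of_list)
qed

lemma pmf_pqrs_step_0:
  assumes "0 \<le> p0" "0 \<le> r0" "0 \<le> s0" "p0 + r0 + s0 = 1"
  shows "pmf (pqrs_step p q r s p0 r0 s0 (Some 0)) y =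
    (if y = Some 1 then p0 else if y = Some 0 then r0 else if y = None then s0 else 0)"
proof -
  have "pmf_of_list_wf [(Some (1::nat), p0), (Some 0, r0), (None, s0)]"
    using assms by (auto simp: pmf_of_list_wf_def)
  then show ?thesis by (auto simp: pmf_pmf_of_list)
qed

end

theory Submission
  imports Defs
begin

text \<open>
  For a fixed target state \<open>n\<close>, the expected number of visits, seen as a function \<open>g\<close> of the starting
  state, satisfies the backward equation \<open>g = \<delta>\<^sub>n + P g\<close>, where \<open>P\<close> is the transition operator of the
  walk on the living states. The right hand side of the theorem is a bounded solution of it, and a
  bounded solution is necessarily the expected number of visits: iterating the equation gives
  \<open>g(i) = (\<Sum>k<K. p\<^sub>i\<^sub>,\<^sub>n\<^sup>(\<^sup>k\<^sup>)) + E g(X\<^sub>K)\<close>, and the remainder is at most \<open>sup \<bar>g\<bar>\<close> times the probability of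
  being alive after \<open>K\<close> steps, which decays geometrically because every living state absorbs
  with probability at least \<open>min s s\<^sub>0\<close>. This proves convergence of the series and the value of its sum at once
  (\<open>backward_solution_sums\<close>, \<open>pqrs_backward_solution_sums\<close>).

  It remains to exhibit the solution. Away from \<open>0\<close> and \<open>n\<close> the backward equation is the linear
  recurrence \<open>(1 - r) g(i) = p g(i+1) + q g(i-1)\<close>, which is solved by \<open>\<xi>\<^sup>1\<^sup>-\<^sup>i\<close> for both roots
  \<open>\<xi>\<^sub>1 > 1 > \<xi>\<^sub>2 > 0\<close> of \<open>q \<xi>\<^sup>2 - (1 - r) \<xi> + p\<close>. To the right of \<open>n\<close> boundedness allows only
  multiples of \<open>\<xi>\<^sub>1\<^sup>1\<^sup>-\<^sup>i\<close>; to the left of \<open>n\<close> the equation at \<open>0\<close> selects the multiples of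
  \<open>\<xi>\<^sub>2\<^sup>1\<^sup>-\<^sup>i - \<xi>\<^sub>1\<^sup>1\<^sup>-\<^sup>i v\<^sub>2/v\<^sub>1\<close>. The two branches agree at \<open>n\<close>, and the factor \<open>\<zeta>\<^sub>1\<close> makes them differ by
  \<open>1/p\<close> at \<open>n + 1\<close>, which produces the source term \<open>\<delta>\<^sub>n\<close>. For the target \<open>n = 0\<close> there is no left
  branch, and the equation at \<open>0\<close> fixes the coefficient \<open>-1/v\<^sub>1\<close>; here \<open>v\<^sub>1 < 0\<close> since
  \<open>p\<^sub>0 < 1 - r\<^sub>0\<close> and \<open>\<xi>\<^sub>1 > 1\<close>.
\<close>

section \<open>Bounded solutions of the backward equation of an absorbed chain\<close>

lemma integral_bind_pmf_bounded:
  fixes f :: "'b \<Rightarrow> real"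
  assumes "\<And>x. \<bar>f x\<bar> \<le> C"
  shows "(\<integral>x. f x \<partial>bind_pmf M N) = (\<integral>x. (\<integral>y. f y \<partial>N x) \<partial>M)"
  unfolding measure_pmf_bind
  by (rule integral_bind[where K = "count_space UNIV" and B = C and B' = 1])
    (use assms measurable_measure_pmf[of N] in
      \<open>auto simp: measure_pmf.emeasure_space_le_1 simp flip: ennreal_1\<close>)

text \<open>
  Uniform absorption is used in the form \<open>P(X\<^sub>k\<^sub>+\<^sub>1 = \<dagger>) \<ge> \<sigma> + (1 - \<sigma>) P(X\<^sub>k = \<dagger>)\<close> with \<open>\<dagger>\<close> for the
  absorbing state, so that the survival probability shrinks by the factor \<open>1 - \<sigma>\<close> in each step.
\<close>

lemma survival_prob_le:
  fixes K :: "'a \<Rightarrow> 'a pmf" and W :: "nat \<Rightarrow> 'a pmf"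
  assumes W_Suc: "\<And>k. W (Suc k) = bind_pmf (W k) K"
    and absorbed: "K dead = return_pmf dead"
    and absorption: "\<And>x. \<sigma> \<le> pmf (K x) dead" and "\<sigma> \<le> 1"
  shows "1 - pmf (W k) dead \<le> (1 - \<sigma>) ^ k"
proof (induction k)
  case 0
  then show ?case by simp
next
  case (Suc k)
  have "pmf (W (Suc k)) dead = (\<integral>x. pmf (K x) dead \<partial>W k)"
    by (simp add: W_Suc pmf_bind)
  also have "\<dots> \<ge> (\<integral>x. \<sigma> + (1 - \<sigma>) * indicator {dead} x \<partial>W k)"
  proof (rule integral_mono)
    show "integrable (W k) (\<lambda>x. \<sigma> + (1 - \<sigma>) * indicator {dead} x)"
      by (rule measure_pmf.integrable_const_bound[where B = "\<bar>\<sigma>\<bar> + \<bar>1 - \<sigma>\<bar>"])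
        (auto simp: indicator_def)
    show "integrable (W k) (\<lambda>x. pmf (K x) dead)"
      by (rule measure_pmf.integrable_const_bound[where B = 1]) (auto simp: pmf_le_1)
    show "\<sigma> + (1 - \<sigma>) * indicator {dead} x \<le> pmf (K x) dead" for x
      using absorption[of x] absorbed by (cases "x = dead") auto
  qed
  also have "(\<integral>x. \<sigma> + (1 - \<sigma>) * indicator {dead} x \<partial>W k) = \<sigma> + (1 - \<sigma>) * pmf (W k) dead"
    by (subst Bochner_Integration.integral_add)
      (auto simp: pmf.rep_eq measure_pmf.integrable_const_bound[where B = 1])
  finally have "1 - pmf (W (Suc k)) dead \<le> (1 - \<sigma>) * (1 - pmf (W k) dead)"
    by (simp add: algebra_simps)
  also have "\<dots> \<le> (1 - \<sigma>) * (1 - \<sigma>) ^ k"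
    using Suc.IH \<open>\<sigma> \<le> 1\<close> by (intro mult_left_mono) auto
  finally show ?case by simp
qed

lemma backward_solution_sums:
  fixes K :: "'a \<Rightarrow> 'a pmf" and W :: "nat \<Rightarrow> 'a pmf" and f :: "'a \<Rightarrow> real"
  assumes W_0: "W 0 = return_pmf x0" and W_Suc: "\<And>k. W (Suc k) = bind_pmf (W k) K"
    and absorbed: "K dead = return_pmf dead"
    and absorption: "\<And>x. \<sigma> \<le> pmf (K x) dead" and \<sigma>: "0 < \<sigma>" "\<sigma> \<le> 1"
    and bound: "\<And>x. \<bar>f x\<bar> \<le> C" and f_dead: "f dead = 0"
    and backward: "\<And>x. f x = indicator {y} x + (\<integral>z. f z \<partial>K x)"
  shows "(\<lambda>k. pmf (W k) y) sums f x0"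
proof -
  have int_f: "integrable (measure_pmf M) f" for M
    using bound by (intro measure_pmf.integrable_const_bound[where B = C]) auto
  define E where "E k = (\<integral>x. f x \<partial>W k)" for k
  have step: "E k = pmf (W k) y + E (Suc k)" for k
  proof -
    have inner: "(\<integral>z. f z \<partial>K x) = f x - indicator {y} x" for x
      using backward[of x] by simp
    have "E (Suc k) = (\<integral>x. (\<integral>z. f z \<partial>K x) \<partial>W k)"
      unfolding E_def W_Suc by (rule integral_bind_pmf_bounded[OF bound])
    also have "\<dots> = (\<integral>x. f x - indicator {y} x \<partial>W k)"
      by (simp add: inner)
    also have "\<dots> = E k - pmf (W k) y"
      by (subst Bochner_Integration.integral_diff)
        (auto simp: int_f E_def pmf.rep_eq measure_pmf.integrable_const_bound[where B = 1])
    finally show ?thesis by simp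
  qed
  have partial: "(\<Sum>k<N. pmf (W k) y) = f x0 - E N" for N
  proof (induction N)
    case 0
    then show ?case by (simp add: E_def W_0)
  next
    case (Suc N)
    then show ?case using step[of N] by simp
  qed
  have "0 \<le> C" using bound[of dead] f_dead by simp
  have E_le: "norm (E N) \<le> C * (1 - \<sigma>) ^ N" for N
  proof -
    have "norm (E N) \<le> (\<integral>x. norm (f x) \<partial>W N)"
      unfolding E_def by (rule integral_norm_bound)
    also have "\<dots> \<le> (\<integral>x. C * (1 - indicator {dead} x) \<partial>W N)"
    proof (rule integral_mono)
      show "integrable (W N) (\<lambda>x. C * (1 - indicator {dead} x))"
        using \<open>0 \<le> C\<close>
        by (intro measure_pmf.integrable_const_bound[where B = C]) (auto simp: indicator_def)
      show "norm (f x) \<le> C * (1 - indicator {dead} x)" for x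
        using bound[of x] f_dead by (auto simp: indicator_def)
    qed (use int_f in auto)
    also have "\<dots> = C * (1 - pmf (W N) dead)"
      by (simp add: pmf.rep_eq measure_pmf.integrable_const_bound[where B = 1])
    also have "\<dots> \<le> C * (1 - \<sigma>) ^ N"
      using \<open>0 \<le> C\<close> survival_prob_le[of W K dead \<sigma> N] W_Suc absorbed absorption \<sigma>
      by (intro mult_left_mono) auto
    finally show ?thesis .
  qed
  have "(\<lambda>N. C * (1 - \<sigma>) ^ N) \<longlonglongrightarrow> 0"
    using \<sigma> by (intro tendsto_mult_right_zero LIMSEQ_power_zero) auto
  then have "E \<longlonglongrightarrow> 0"
    by (rule Lim_null_comparison[rotated]) (simp add: E_le[unfolded real_norm_def])
  then have "(\<lambda>N. f x0 - E N) \<longlonglongrightarrow> f x0 - 0"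
    by (intro tendsto_intros)
  then show ?thesis by (simp add: sums_def partial)
qed

text \<open>Extending \<open>g\<close> by \<open>0\<close> to the absorbed state \<open>None\<close> accounts for the killing terms \<open>s\<close> and \<open>s\<^sub>0\<close>.\<close>

lemma pqrs_backward_solution_sums:
  fixes g :: "nat \<Rightarrow> real"
  assumes pqrs: "p \<ge> 0" "q \<ge> 0" "r \<ge> 0" "s > 0" "p + q + r + s = 1"
    and pqrs0: "p0 \<ge> 0" "r0 \<ge> 0" "s0 > 0" "p0 + r0 + s0 = 1"
    and bound: "\<And>i. \<bar>g i\<bar> \<le> C"
    and at_0: "g 0 = of_bool (n = 0) + p0 * g 1 + r0 * g 0"
    and at_Suc: "\<And>m. g (Suc m) =
      of_bool (n = Suc m) + p * g (m + 2) + q * g m + r * g (Suc m)"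
  shows "pqrs_prob p q r s p0 r0 s0 i n sums g i"
proof -
  define f where "f x = (case x of None \<Rightarrow> 0 | Some i \<Rightarrow> g i)" for x
  have f_Some: "f (Some i) = g i" for i
    by (simp add: f_def)
  let ?K = "pqrs_step p q r s p0 r0 s0"
  note pmf_0 = pmf_pqrs_step_0[of p0 r0 s0 p q r s, OF _ _ _ pqrs0(4)]
  note pmf_Suc = pmf_pqrs_step_Suc[of p q r s p0 r0 s0, OF _ _ _ _ pqrs(5)]
  have step_0: "(\<integral>z. f z \<partial>?K (Some 0)) = p0 * g 1 + r0 * g 0"
    by (subst integral_measure_pmf_real[where A = "{Some 1, Some 0, None}"])
      (use pqrs0 in \<open>auto simp: pmf_0 set_pmf_iff f_def simp del: pqrs_step.simps split: if_splits\<close>)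
  have step_Suc: "(\<integral>z. f z \<partial>?K (Some (Suc m))) = p * g (m + 2) + q * g m + r * g (Suc m)" for m
    by (subst integral_measure_pmf_real[where A = "{Some (m + 2), Some m, Some (m + 1), None}"])
      (use pqrs in \<open>auto simp: pmf_Suc set_pmf_iff f_def simp del: pqrs_step.simps split: if_splits\<close>)
  have "(\<lambda>k. pmf (pqrs_walk p q r s p0 r0 s0 i k) (Some n)) sums f (Some i)"
  proof (rule backward_solution_sums[where K = ?K and dead = None and \<sigma> = "min s s0" and C = C])
    show "min s s0 \<le> pmf (?K x) None" for x
    proof (cases x)
      case None
      then show ?thesis using pqrs by simp
    next
      case (Some j)
      then show ?thesis
        using pqrs pqrs0
        by (cases j) (simp_all add: pmf_0 pmf_Suc del: pqrs_step.simps)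
    qed
    show "\<bar>f x\<bar> \<le> C" for x
      using bound order_trans[OF abs_ge_zero bound] by (auto simp: f_def split: option.split)
    show "f x = indicator {Some n} x + (\<integral>z. f z \<partial>?K x)" for x
    proof (cases x)
      case None
      then show ?thesis by (simp add: f_def)
    next
      case (Some j)
      then show ?thesis
        using at_0 at_Suc[of "j - 1"]
        by (cases j) (auto simp: f_Some step_0 step_Suc indicator_def simp del: pqrs_step.simps)
    qed
  qed (use pqrs pqrs0 in \<open>auto simp: f_def\<close>)
  then show ?thesis
    by (simp add: pqrs_prob_def[abs_def] f_def)
qed

section \<open>The roots of the characteristic equation\<close>

text \<open>
  The location of the larger root comes from the value \<open>-s\<close> of \<open>q \<xi>\<^sup>2 - (1 - r) \<xi> + p\<close> at \<open>1\<close>: it is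
  negative, so \<open>1\<close> lies strictly between the roots.
\<close>

lemma xi_facts:
  fixes p q r s :: real
  assumes "p > 0" "q > 0" "s > 0" "p + q + r + s = 1"
  shows xi_add: "q * (xi1 p q r + xi2 p q r) = 1 - r"
    and xi_mult: "q * (xi1 p q r * xi2 p q r) = p"
    and zeta1_xi_diff: "q * zeta1 p q r * (xi1 p q r - xi2 p q r) = 1"
    and xi1_gt_1: "xi1 p q r > 1"
    and xi2_pos: "xi2 p q r > 0"
proof -
  define D where "D = (1 - r)\<^sup>2 - 4 * p * q"
  define d where "d = sqrt D"
  have "(p + q)\<^sup>2 < (1 - r)\<^sup>2"
    using assms by (intro power_strict_mono) auto
  moreover have "4 * p * q \<le> (p + q)\<^sup>2"
    using zero_le_power2[of "p - q"] by (simp add: power2_eq_square algebra_simps)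
  ultimately have "D > 0" by (simp add: D_def)
  then have d: "d > 0" "d\<^sup>2 = (1 - r)\<^sup>2 - 4 * p * q"
    by (simp_all add: d_def) (simp add: D_def)
  have xi1: "xi1 p q r = ((1 - r) + d) / (2 * q)" and xi2: "xi2 p q r = ((1 - r) - d) / (2 * q)"
    by (simp_all add: xi1_def xi2_def d_def D_def)
  have zeta: "zeta1 p q r = 1 / d"
    using \<open>D > 0\<close>
    by (simp add: zeta1_def d_def powr_minus powr_half_sqrt inverse_eq_divide flip: D_def)
  show add: "q * (xi1 p q r + xi2 p q r) = 1 - r"
    using assms by (simp add: xi1 xi2 field_simps)
  have "(1 - r + d) * (1 - r - d) = 4 * p * q"
    using d(2) by (simp add: power2_eq_square algebra_simps)
  then show mult: "q * (xi1 p q r * xi2 p q r) = p"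
    using assms by (simp add: xi1 xi2)
  show "q * zeta1 p q r * (xi1 p q r - xi2 p q r) = 1"
    using assms d by (simp add: xi1 xi2 zeta field_simps)
  have "xi2 p q r < xi1 p q r"
    using assms d by (simp add: xi1 xi2 divide_strict_right_mono)
  have "q * ((xi1 p q r - 1) * (1 - xi2 p q r)) = s"
    using add mult assms by (simp add: algebra_simps)
  then have "(xi1 p q r - 1) * (1 - xi2 p q r) > 0"
    using assms by (metis zero_less_mult_pos)
  then show "xi1 p q r > 1"
    using \<open>xi2 p q r < xi1 p q r\<close> by (auto simp: zero_less_mult_iff)
  have "xi1 p q r * xi2 p q r > 0"
    using mult assms by (metis zero_less_mult_pos)
  then show "xi2 p q r > 0"
    using \<open>xi1 p q r > 1\<close> by (simp add: zero_less_mult_iff)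
qed

lemma char_root_powi_recurrence:
  fixes x :: real
  assumes "x \<noteq> 0" and root: "q * x\<^sup>2 - (1 - r) * x + p = 0"
  shows "x powi (1 - int (Suc m)) =
    p * x powi (1 - int (m + 2)) + q * x powi (1 - int m) + r * x powi (1 - int (Suc m))"
proof -
  let ?w = "x powi (1 - int (m + 2))"
  have "1 - int (Suc m) = (1 - int (m + 2)) + 1" "1 - int m = (1 - int (m + 2)) + 2"
    by auto
  then have "x powi (1 - int (Suc m)) = ?w * x" "x powi (1 - int m) = ?w * x\<^sup>2"
    using \<open>x \<noteq> 0\<close> power_int_add[of x "1 - int (m + 2)" 1] power_int_add[of x "1 - int (m + 2)" 2]
    by simp_all
  moreover have "?w * (q * x\<^sup>2 - (1 - r) * x + p) = 0"
    using root by simp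
  ultimately show ?thesis by (simp add: algebra_simps)
qed

lemma powi_one_minus_le:
  fixes x :: real
  assumes "x \<ge> 1"
  shows "x powi (1 - int i) \<le> x"
  using power_int_increasing[of "1 - int i" 1 x] assms by simp

section \<open>The expected number of visits\<close>

theorem theorem5:
  fixes p q r s p0 r0 s0 :: real and i0 :: nat
  assumes "p > 0" and "q > 0" and "s > 0" and "r \<ge> 0" and "p + q + r + s = 1"
    and "p0 > 0" and "s0 > 0" and "r0 \<ge> 0" and "p0 + r0 + s0 = 1"
  shows
    "(\<lambda>k. pqrs_prob p q r s p0 r0 s0 i0 0 k) sums
       (- inverse (v1 p q r p0 r0) * xi1 p q r powi (1 - int i0))
     \<and> (\<forall>n. 0 < n \<and> n \<le> i0 \<longrightarrow>
         (\<lambda>k. pqrs_prob p q r s p0 r0 s0 i0 n k) sums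
           (zeta1 p q r * xi1 p q r powi (1 - int i0) *
             (xi1 p q r ^ (n - 1)
               - xi2 p q r ^ (n - 1) * v2 p q r p0 r0 * inverse (v1 p q r p0 r0))))
     \<and> (\<forall>n. i0 \<le> n \<and> 1 \<le> n \<longrightarrow>
         (\<lambda>k. pqrs_prob p q r s p0 r0 s0 i0 n k) sums
           (zeta1 p q r * xi2 p q r ^ (n - 1) *
             (xi2 p q r powi (1 - int i0)
               - xi1 p q r powi (1 - int i0) * v2 p q r p0 r0 * inverse (v1 p q r p0 r0))))"
proof -
  define x1 x2 z w1 w2 where
    "x1 = xi1 p q r" and "x2 = xi2 p q r" and "z = zeta1 p q r"
    and "w1 = v1 p q r p0 r0" and "w2 = v2 p q r p0 r0"
  note defs = x1_def x2_def z_def w1_def w2_def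
  note facts = xi_facts[OF assms(1-3,5), folded defs]
  have w: "w1 = p0 - (1 - r0) * x1" "w2 = p0 - (1 - r0) * x2"
    by (simp_all add: defs v1_def v2_def)
  define a1 a2 where "a1 i = x1 powi (1 - int i)" and "a2 i = x2 powi (1 - int i)" for i
  have x: "x1 > 1" "x1 > 0" "x2 > 0"
    using facts by auto
  have p_eq: "p = q * (x1 * x2)" and r_eq: "1 - r = q * (x1 + x2)"
    using facts by simp_all
  have rec1: "a1 (Suc m) = p * a1 (m + 2) + q * a1 m + r * a1 (Suc m)" for m
    unfolding a1_def using x
    by (intro char_root_powi_recurrence) (auto simp: r_eq p_eq power2_eq_square algebra_simps)
  have rec2: "a2 (Suc m) = p * a2 (m + 2) + q * a2 m + r * a2 (Suc m)" for m
    unfolding a2_def using x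
    by (intro char_root_powi_recurrence) (auto simp: r_eq p_eq power2_eq_square algebra_simps)
  have a_init: "a1 0 = x1" "a2 0 = x2" "a1 (Suc 0) = 1" "a2 (Suc 0) = 1"
    by (simp_all add: a1_def a2_def)
  have a1_bound: "\<bar>a1 i\<bar> \<le> x1" for i
    using x powi_one_minus_le[of x1 i] by (simp add: a1_def)
  have "w1 < 0"
  proof -
    have "p0 < 1 - r0" using assms by linarith
    also have "\<dots> \<le> (1 - r0) * x1"
      using mult_left_mono[of 1 x1 "1 - r0"] assms x by simp
    finally show ?thesis by (simp add: w)
  qed
  note sums = pqrs_backward_solution_sums[of p q r s p0 r0 s0]

  have visits_0: "pqrs_prob p q r s p0 r0 s0 i0 0 sums (- inverse w1 * a1 i0)"
  proof (rule sums[where C = "\<bar>inverse w1\<bar> * x1" and g = "\<lambda>i. - inverse w1 * a1 i"])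
    show "\<bar>- inverse w1 * a1 i\<bar> \<le> \<bar>inverse w1\<bar> * x1" for i
      using a1_bound[of i] by (simp add: abs_mult mult_left_mono)
    show "- inverse w1 * a1 0 =
        of_bool ((0::nat) = 0) + p0 * (- inverse w1 * a1 1) + r0 * (- inverse w1 * a1 0)"
    proof -
      have "inverse w1 * (p0 - (1 - r0) * x1) = 1"
        using \<open>w1 < 0\<close> by (simp flip: w(1))
      then show ?thesis by (simp add: a_init algebra_simps)
    qed
    show "- inverse w1 * a1 (Suc m) = of_bool (0 = Suc m) + p * (- inverse w1 * a1 (m + 2))
        + q * (- inverse w1 * a1 m) + r * (- inverse w1 * a1 (Suc m))" for m
      by (subst rec1) (simp add: algebra_simps)
  qed (use assms in auto)

  \<comment> \<open>The branches of the solution to the left and to the right of the target \<open>n\<close>.\<close>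
  define L where "L n i = z * x2 ^ (n - 1) * (a2 i - a1 i * w2 * inverse w1)" for n i
  define R where "R n i = z * a1 i * (x1 ^ (n - 1) - x2 ^ (n - 1) * w2 * inverse w1)" for n i
  have L_rec: "L n (Suc m) = p * L n (m + 2) + q * L n m + r * L n (Suc m)" for n m
    unfolding L_def by (subst rec1, subst rec2) (simp add: algebra_simps)
  have R_rec: "R n (Suc m) = p * R n (m + 2) + q * R n m + r * R n (Suc m)" for n m
    unfolding R_def by (subst rec1) (simp add: algebra_simps)
  have L_0: "L n 0 = p0 * L n 1 + r0 * L n 0" for n
  proof -
    have "(1 - r0) * (x2 * w1 - x1 * w2) = p0 * (w1 - w2)"
      by (simp add: w algebra_simps)
    then have "(1 - r0) * (x2 - x1 * w2 * inverse w1) = p0 * (1 - w2 * inverse w1)"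
      using \<open>w1 < 0\<close> by (simp add: field_simps)
    then have "z * x2 ^ (n - 1) * ((1 - r0) * (x2 - x1 * w2 * inverse w1)) =
        z * x2 ^ (n - 1) * (p0 * (1 - w2 * inverse w1))"
      by simp
    then show ?thesis by (simp add: L_def a_init algebra_simps)
  qed
  have diff: "L n i - R n i = z * (x2 ^ (n - 1) * a2 i - x1 ^ (n - 1) * a1 i)" for n i
    by (simp add: L_def R_def algebra_simps)
  have agree: "L n n = R n n" and jump: "p * (L n (Suc n) - R n (Suc n)) = 1" if "n \<ge> 1" for n
  proof -
    obtain m where n: "n = Suc m"
      using \<open>n \<ge> 1\<close> by (cases n) auto
    have "1 - int n = - int m" "1 - int (Suc n) = - int n"
      by (simp_all add: n)
    then have cancel: "y ^ (n - 1) * y powi (1 - int n) = 1"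
      and cancel_Suc: "y ^ (n - 1) * y powi (1 - int (Suc n)) = inverse y" if "y > 0" for y :: real
      using that by (simp_all only: power_int_minus power_int_of_nat) (simp_all add: n)
    show "L n n = R n n"
      using diff[of n n] cancel[of x1] cancel[of x2] x by (simp add: a1_def a2_def)
    have "p * (L n (Suc n) - R n (Suc n)) = p * (z * (inverse x2 - inverse x1))"
      unfolding diff a1_def a2_def cancel_Suc[OF x(2)] cancel_Suc[OF x(3)] ..
    also have "\<dots> = q * z * (x1 - x2)"
      using x by (simp add: p_eq field_simps)
    finally show "p * (L n (Suc n) - R n (Suc n)) = 1"
      using facts by simp
  qed

  have visits: "pqrs_prob p q r s p0 r0 s0 i0 n sums (if i0 \<le> n then L n i0 else R n i0)"
    if "n \<ge> 1" for n
  proof -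
    define g where "g i = (if i \<le> n then L n i else R n i)" for i
    define B where "B = \<bar>z\<bar> * x1 * \<bar>x1 ^ (n - 1) - x2 ^ (n - 1) * w2 * inverse w1\<bar>"
    have R_bound: "\<bar>R n i\<bar> \<le> B" for i
      using a1_bound[of i] unfolding R_def B_def abs_mult
      by (intro mult_right_mono mult_left_mono) auto
    have "B \<ge> 0" using x by (simp add: B_def)
    have "pqrs_prob p q r s p0 r0 s0 i0 n sums g i0"
    proof (rule sums[where C = "B + (\<Sum>j\<le>n. \<bar>L n j\<bar>)"])
      show "\<bar>g i\<bar> \<le> B + (\<Sum>j\<le>n. \<bar>L n j\<bar>)" for i
      proof (cases "i \<le> n")
        case True
        then have "\<bar>L n i\<bar> \<le> (\<Sum>j\<le>n. \<bar>L n j\<bar>)"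
          by (intro member_le_sum) auto
        then show ?thesis using True \<open>B \<ge> 0\<close> by (simp add: g_def)
      next
        case False
        then show ?thesis
          using add_mono[OF R_bound[of i] sum_nonneg[of "{..n}" "\<lambda>j. \<bar>L n j\<bar>"]]
          by (simp add: g_def)
      qed
      show "g 0 = of_bool (n = 0) + p0 * g 1 + r0 * g 0"
        using L_0[of n] \<open>n \<ge> 1\<close> by (simp add: g_def)
      show "g (Suc m) = of_bool (n = Suc m) + p * g (m + 2) + q * g m + r * g (Suc m)" for m
      proof -
        consider "m + 2 \<le> n" | "n = Suc m" | "n = m" | "n < m" by linarith
        then show ?thesis
        proof cases
          case 1
          then show ?thesis using L_rec[of n m] by (simp add: g_def)
        next
          case 2
          \<comment> \<open>\<open>L\<close> solves the homogeneous equation here; replacing \<open>L\<close> by \<open>R\<close> at \<open>n + 1\<close> leaves exactly the source \<open>1\<close>.\<close>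
          then show ?thesis
            using L_rec[of n m] jump[OF \<open>n \<ge> 1\<close>] by (simp add: g_def algebra_simps)
        next
          case 3
          \<comment> \<open>The left neighbour is \<open>n\<close> itself, where \<open>g\<close> is given by \<open>L\<close> but equals \<open>R\<close> as well.\<close>
          then show ?thesis
            using R_rec[of n m] agree[OF \<open>n \<ge> 1\<close>] by (simp add: g_def)
        next
          case 4
          then show ?thesis using R_rec[of n m] by (simp add: g_def)
        qed
      qed
    qed (use assms in auto)
    then show ?thesis by (simp add: g_def)
  qed
  have "pqrs_prob p q r s p0 r0 s0 i0 n sums R n i0" if "0 < n" "n \<le> i0" for n
    using visits[of n] agree[of n] that by (cases "i0 = n") auto
  moreover have "pqrs_prob p q r s p0 r0 s0 i0 n sums L n i0" if "i0 \<le> n" "1 \<le> n" for n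
    using visits[of n] that by auto
  ultimately show ?thesis
    using visits_0 unfolding L_def R_def a1_def a2_def defs by blast
qed

end
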